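(* Let $K_{a,b}$ be the complete bipartite graph with parts of sizes $a$ and $b$, and let $k$ be a positive integer with $k<a\le b$. Then $$b_t^k(K_{a,b})\le ka.$$
   Context: $\gamma_t(K_{a,b})=2$ for $2\le a\le b$. A total dominating set of a graph without isolated vertices is a vertex set $S$ such that every vertex is adjacent to some vertex of $S$; $\gamma_t(G)$ is the minimum size of such a set. The $k$-total bondage number $b_t^k(G)$ is the minimum number of edges that must be deleted from $G$ so that the resulting graph (required to have no isolated vertices) has total domination number at least $\gamma_t(G)+k$. *)

theory Defs
  imports Main "HOL-Library.Extended_Nat"
begin

text \<open>A finite simple graph is a vertex set \<open>V\<close> with a set \<open>E\<close> of two-element subsets of \<open>V\<close>.\<close>

definition simple_graph :: "'a set \<Rightarrow> 'a set set \<Rightarrow> bool" where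
  "simple_graph V E \<longleftrightarrow> finite V \<and> (\<forall>e\<in>E. e \<subseteq> V \<and> card e = 2)"

definition adjacent :: "'a set set \<Rightarrow> 'a \<Rightarrow> 'a \<Rightarrow> bool" where
  "adjacent E u v \<longleftrightarrow> {u, v} \<in> E"

definition no_isolated_vertices :: "'a set \<Rightarrow> 'a set set \<Rightarrow> bool" where
  "no_isolated_vertices V E \<longleftrightarrow> (\<forall>v\<in>V. \<exists>u\<in>V. adjacent E v u)"

definition total_dominating_set :: "'a set \<Rightarrow> 'a set set \<Rightarrow> 'a set \<Rightarrow> bool" where
  "total_dominating_set V E S \<longleftrightarrow> S \<subseteq> V \<and> (\<forall>v\<in>V. \<exists>u\<in>S. adjacent E v u)"

text \<open>Both minima below are infima in \<^typ>\<open>enat\<close>: a minimum over an empty family is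
  \<open>\<infinity>\<close> (whereas the infimum of the empty set of natural numbers would be \<open>0\<close>), and over
  a nonempty family the infimum is attained.  They are meant for finite simple graphs.\<close>

definition total_domination_number :: "'a set \<Rightarrow> 'a set set \<Rightarrow> enat" where
  "total_domination_number V E = (INF S \<in> {S. total_dominating_set V E S}. enat (card S))"

definition total_bondage_number :: "nat \<Rightarrow> 'a set \<Rightarrow> 'a set set \<Rightarrow> enat" where
  "total_bondage_number k V E =
     (INF F \<in> {F. F \<subseteq> E \<and> no_isolated_vertices V (E - F) \<and>
                  total_domination_number V (E - F) \<ge> total_domination_number V E + enat k}.
        enat (card F))"

definition complete_bipartite_edges :: "'a set \<Rightarrow> 'a set \<Rightarrow> 'a set set" where
  "complete_bipartite_edges A B = {{x, y} | x y. x \<in> A \<and> y \<in> B}"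

lemma simple_graph_complete_bipartite:
  assumes "finite A" "finite B" "A \<inter> B = {}"
  shows "simple_graph (A \<union> B) (complete_bipartite_edges A B)"
proof -
  have "{x, y} \<subseteq> A \<union> B \<and> card {x, y} = 2" if "x \<in> A" "y \<in> B" for x y
  proof -
    have "x \<noteq> y" using that assms(3) by blast
    then show ?thesis using that by simp
  qed
  then show ?thesis
    using assms(1,2) unfolding simple_graph_def complete_bipartite_edges_def by blast
qed

lemma simple_graph_delete_edges: "simple_graph V E \<Longrightarrow> simple_graph V (E - F)"
  by (simp add: simple_graph_def)

lemma adjacent_complete_bipartite:
  "adjacent (complete_bipartite_edges A B) u v \<longleftrightarrow> u \<in> A \<and> v \<in> B \<or> u \<in> B \<and> v \<in> A"
  by (auto simp: adjacent_def complete_bipartite_edges_def doubleton_eq_iff)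

lemma total_domination_number_complete_bipartite:
  assumes fin: "finite A" "finite B" and disj: "A \<inter> B = {}" and ne: "A \<noteq> {}" "B \<noteq> {}"
  shows "total_domination_number (A \<union> B) (complete_bipartite_edges A B) = 2"
proof (rule antisym)
  obtain x y where xy: "x \<in> A" "y \<in> B" using ne by blast
  then have "x \<noteq> y" using disj by blast
  then have "enat (card {x, y}) = 2" by (simp add: numeral_eq_enat)
  moreover have "total_dominating_set (A \<union> B) (complete_bipartite_edges A B) {x, y}"
    using xy by (auto simp: total_dominating_set_def adjacent_complete_bipartite)
  ultimately show "total_domination_number (A \<union> B) (complete_bipartite_edges A B) \<le> 2"
    unfolding total_domination_number_def by (intro INF_lower2[of "{x, y}"]) simp_all
next
  show "2 \<le> total_domination_number (A \<union> B) (complete_bipartite_edges A B)"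
    unfolding total_domination_number_def
  proof (rule INF_greatest)
    fix S assume "S \<in> {S. total_dominating_set (A \<union> B) (complete_bipartite_edges A B) S}"
    then have S: "S \<subseteq> A \<union> B" "\<forall>v\<in>A \<union> B. \<exists>u\<in>S. adjacent (complete_bipartite_edges A B) v u"
      by (auto simp: total_dominating_set_def)
    obtain x y where "x \<in> A" "y \<in> B" using ne by blast
    then obtain u w where "u \<in> S" "adjacent (complete_bipartite_edges A B) x u"
      "w \<in> S" "adjacent (complete_bipartite_edges A B) y w"
      using S(2) by (meson UnI1 UnI2)
    then have "u \<in> S" "u \<in> B" "w \<in> S" "w \<in> A"
      using \<open>x \<in> A\<close> \<open>y \<in> B\<close> disj by (auto simp: adjacent_complete_bipartite)
    then have "{u, w} \<subseteq> S" "u \<noteq> w" using disj by auto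
    then have "{u, w} \<subseteq> S" "card {u, w} = 2" by simp_all
    moreover have "finite S" using S(1) fin by (meson finite_UnI finite_subset)
    ultimately have "2 \<le> card S" using card_mono[of S "{u, w}"] by simp
    then show "2 \<le> enat (card S)" by (simp add: numeral_eq_enat)
  qed
qed

end

theory Submission imports Defs begin

text \<open>Choose \<open>k + 1\<close> vertices \<open>Y \<subseteq> B\<close> and a surjection \<open>f\<close> from \<open>A\<close> onto \<open>Y\<close>, and delete all edges
  between \<open>A\<close> and \<open>Y\<close> except those joining \<open>x\<close> to \<open>f x\<close>.  Every \<open>x\<close> loses \<open>k\<close> edges.  The
  neighbourhoods of the vertices of \<open>Y\<close> are now the pairwise disjoint fibres of \<open>f\<close>, so dominating
  \<open>Y\<close> takes \<open>k + 1\<close> vertices of \<open>A\<close>, and dominating \<open>A\<close> takes one more vertex of \<open>B\<close>.\<close>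

text \<open>Being an image of a dependent sum over \<open>A\<close>, it has its size bounded by a
  sum over \<open>A\<close> of the sizes of the slices.\<close>

definition fibre_cut :: "'a set \<Rightarrow> 'a set \<Rightarrow> ('a \<Rightarrow> 'a) \<Rightarrow> 'a set set" where
  "fibre_cut A Y f = (\<lambda>(x, y). {x, y}) ` (SIGMA x:A. Y - {f x})"

lemma fibre_cut_subset:
  assumes "Y \<subseteq> B"
  shows "fibre_cut A Y f \<subseteq> complete_bipartite_edges A B"
  using assms by (auto simp: fibre_cut_def complete_bipartite_edges_def)

lemma card_fibre_cut_le:
  assumes "finite A" "finite Y" "f ` A \<subseteq> Y"
  shows "card (fibre_cut A Y f) \<le> (card Y - 1) * card A"
proof -
  have "card (fibre_cut A Y f) \<le> card (SIGMA x:A. Y - {f x})"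
    unfolding fibre_cut_def using assms by (intro card_image_le) auto
  also have "\<dots> = (\<Sum>x\<in>A. card (Y - {f x}))"
    using assms by simp
  \<comment> \<open>As \<open>f x\<close> lies in \<open>Y\<close>, exactly one edge from
    \<open>x\<close> into \<open>Y\<close> survives.\<close>
  also have "\<dots> = (\<Sum>x\<in>A. card Y - 1)"
    using assms by (intro sum.cong) auto
  finally show ?thesis by (simp add: mult.commute)
qed

text \<open>Disjointness of \<open>A\<close> and \<open>B\<close> excludes the swapped reading of
  the doubleton, so the edge determines the pair.\<close>

lemma doubleton_in_fibre_cut_iff:
  assumes "A \<inter> B = {}" "Y \<subseteq> B" "x \<in> A" "y \<in> B"
  shows "{x, y} \<in> fibre_cut A Y f \<longleftrightarrow> y \<in> Y \<and> y \<noteq> f x"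
  using assms by (auto simp: fibre_cut_def image_iff doubleton_eq_iff)

lemma adjacent_commute: "adjacent E u v \<longleftrightarrow> adjacent E v u"
  by (simp add: adjacent_def insert_commute)

lemma adjacent_delete_fibre_cut:
  assumes "A \<inter> B = {}" "Y \<subseteq> B" "x \<in> A"
  shows "adjacent (complete_bipartite_edges A B - fibre_cut A Y f) x v
    \<longleftrightarrow> v \<in> B \<and> (v \<in> Y \<longrightarrow> v = f x)"
proof (cases "v \<in> B")
  case True
  then show ?thesis
    using assms doubleton_in_fibre_cut_iff[OF assms True]
    by (auto simp: adjacent_def complete_bipartite_edges_def)
next
  case False
  then have "\<not> adjacent (complete_bipartite_edges A B) x v"
    using assms by (auto simp: adjacent_complete_bipartite)
  then show ?thesis
    using False by (simp add: adjacent_def)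
qed

text \<open>Each \<open>x\<close> in \<open>A\<close> keeps \<open>f x\<close>, each vertex of
  \<open>Y\<close> keeps its preimages under \<open>f\<close>, and vertices of \<open>B - Y\<close>
  lose nothing.\<close>

lemma no_isolated_vertices_delete_fibre_cut:
  assumes "A \<inter> B = {}" "Y \<subseteq> B" "f ` A = Y" "A \<noteq> {}"
  shows "no_isolated_vertices (A \<union> B) (complete_bipartite_edges A B - fibre_cut A Y f)"
    (is "no_isolated_vertices _ ?E")
  unfolding no_isolated_vertices_def
proof
  note adj = adjacent_delete_fibre_cut[OF assms(1,2)]
  fix v assume "v \<in> A \<union> B"
  then consider "v \<in> A" | "v \<in> Y" | "v \<in> B - Y" by blast
  then show "\<exists>u\<in>A \<union> B. adjacent ?E v u"
  proof cases
    case 1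
    then have "adjacent ?E v (f v)" "f v \<in> B"
      using assms by (auto simp: adj)
    then show ?thesis by blast
  next
    case 2
    then obtain x where "x \<in> A" "v = f x" using assms by blast
    then have "adjacent ?E x v" using assms by (auto simp: adj)
    then show ?thesis using \<open>x \<in> A\<close> adjacent_commute[of ?E v x] by blast
  next
    case 3
    obtain x where "x \<in> A" using assms by blast
    then have "adjacent ?E x v" using 3 by (auto simp: adj)
    then show ?thesis using \<open>x \<in> A\<close> adjacent_commute[of ?E v x] by blast
  qed
qed

lemma total_domination_number_delete_fibre_cut_ge:
  assumes "finite A" "finite B" "A \<inter> B = {}" "Y \<subseteq> B" "A \<noteq> {}"
  shows "enat (card Y + 1)
    \<le> total_domination_number (A \<union> B) (complete_bipartite_edges A B - fibre_cut A Y f)"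
    (is "_ \<le> total_domination_number _ ?E")
  unfolding total_domination_number_def
proof (rule INF_greatest)
  note adj = adjacent_delete_fibre_cut[OF assms(3,4)]
  fix S assume "S \<in> {S. total_dominating_set (A \<union> B) ?E S}"
  then have S: "S \<subseteq> A \<union> B" and dom: "\<And>v. v \<in> A \<union> B \<Longrightarrow> \<exists>u\<in>S. adjacent ?E v u"
    by (auto simp: total_dominating_set_def)
  have "finite S" using S assms by (meson finite_UnI finite_subset)
  \<comment> \<open>A vertex \<open>u\<close> of \<open>S\<close> dominating \<open>y\<close> in
    \<open>Y\<close> lies in \<open>A\<close>, and its only remaining neighbour in \<open>Y\<close>
    is \<open>f u\<close>.\<close>
  have "Y \<subseteq> f ` (S \<inter> A)"
  proof
    fix y assume "y \<in> Y"
    then have "y \<in> B" using assms by blast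
    then obtain u where u: "u \<in> S" "adjacent ?E y u" using dom by blast
    then have "adjacent (complete_bipartite_edges A B) y u"
      by (simp add: adjacent_def)
    then have "u \<in> A"
      using \<open>y \<in> B\<close> assms by (auto simp: adjacent_complete_bipartite)
    moreover from this have "y = f u"
      using u \<open>y \<in> Y\<close> adjacent_commute[of ?E y u] by (simp add: adj)
    ultimately show "y \<in> f ` (S \<inter> A)" using u by blast
  qed
  then have "card Y \<le> card (S \<inter> A)"
    using \<open>finite S\<close> by (meson finite_Int surj_card_le)
  \<comment> \<open>A vertex of \<open>A\<close> has all its neighbours in \<open>B\<close>, so
    \<open>S\<close> also meets \<open>B\<close>; this supplies the extra 1.\<close>
  moreover obtain x where "x \<in> A" using assms by blast
  then obtain u where "u \<in> S" "u \<in> B" using dom[of x] by (auto simp: adj)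
  then have "S \<inter> A \<subset> S" using assms by blast
  then have "card (S \<inter> A) < card S" using \<open>finite S\<close> by (rule psubset_card_mono[rotated])
  ultimately show "enat (card Y + 1) \<le> enat (card S)" by simp
qed

text \<open>Invert an injection of \<open>Y\<close> into \<open>A\<close> on its image and send the
  rest of \<open>A\<close> to a fixed point of \<open>Y\<close>.\<close>

lemma ex_surj_on_of_card_le:
  assumes "finite A" "finite Y" "Y \<noteq> {}" "card Y \<le> card A"
  shows "\<exists>f. f ` A = Y"
proof -
  obtain g where g: "g ` Y \<subseteq> A" "inj_on g Y"
    using card_le_inj[OF assms(2,1,4)] by blast
  obtain y0 where "y0 \<in> Y" using assms by blast
  let ?f = "\<lambda>x. if x \<in> g ` Y then inv_into Y g x else y0"
  have "?f ` A \<subseteq> Y"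
    using \<open>y0 \<in> Y\<close> by (auto intro: inv_into_into)
  moreover have "y \<in> ?f ` A" if "y \<in> Y" for y
    using that g by (intro image_eqI[of _ _ "g y"]) auto
  ultimately show ?thesis by blast
qed

theorem theorem3p18:
  fixes A B :: "'a set" and a b k :: nat
  assumes "finite A" and "finite B" and "A \<inter> B = {}"
    and "card A = a" and "card B = b"
    and "0 < k" and "k < a" and "a \<le> b"
  shows "total_bondage_number k (A \<union> B) (complete_bipartite_edges A B) \<le> enat (k * a)"
proof -
  have ne: "A \<noteq> {}" "B \<noteq> {}" using assms by auto
  \<comment> \<open>Size \<open>k + 1\<close> for \<open>Y\<close> makes the lower bound
    \<open>card Y + 1\<close> equal to \<open>2 + k\<close>, with \<open>k\<close> edges lost per
    vertex of \<open>A\<close>; \<open>k < a\<close> leaves room for a surjection from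
    \<open>A\<close>.\<close>
  have "k + 1 \<le> card B" using assms by simp
  then obtain Y where Y: "Y \<subseteq> B" "card Y = k + 1" "finite Y"
    by (rule obtain_subset_with_card_n)
  then have "Y \<noteq> {}" "card Y \<le> card A" using assms by auto
  then obtain f where f: "f ` A = Y"
    using ex_surj_on_of_card_le[OF assms(1) Y(3)] by auto
  let ?E = "complete_bipartite_edges A B" and ?F = "fibre_cut A Y f"
  have "total_domination_number (A \<union> B) ?E + enat k = enat (card Y + 1)"
    using total_domination_number_complete_bipartite[OF assms(1-3) ne] Y(2)
    by (simp add: numeral_eq_enat)
  then have "total_domination_number (A \<union> B) ?E + enat k
      \<le> total_domination_number (A \<union> B) (?E - ?F)"
    using total_domination_number_delete_fibre_cut_ge[OF assms(1-3) Y(1) ne(1)] by simp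
  moreover have "no_isolated_vertices (A \<union> B) (?E - ?F)"
    using no_isolated_vertices_delete_fibre_cut[OF assms(3) Y(1) f ne(1)] .
  moreover have "card ?F \<le> k * a"
    using card_fibre_cut_le[OF assms(1) Y(3), of f] f Y(2) assms(4) by simp
  ultimately show ?thesis
    unfolding total_bondage_number_def
    using fibre_cut_subset[OF Y(1)] by (intro INF_lower2[of ?F]) simp_all
qed

end
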